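(* Let $n\ge 1$ be an integer, $p>2$, $\alpha>0$, and $f\in C^2([0,\infty))$. Set $$\bar\beta=\frac{p}{2(p-1)},\qquad a=\bar\beta^{\,p},\qquad A=\bar\beta^{\,p-1}(\bar\beta-1)+\frac{n-1}{p-1}\,\bar\beta^{\,p-1}.$$ Then the change of variables $z=r^{\bar\beta}=r^{\frac{p}{2(p-1)}}$ transforms the initial value problem $$u''(r)+\frac{n-1}{(p-1)r}\,u'(r)+\frac{f(u(r))}{(p-1)\,|u'(r)|^{p-2}}=0,\qquad u(0)=\alpha,\quad u'(0)=0,$$ into the initial value problem $$a\,u''(z)+\frac{A}{z}\,u'(z)+\frac{z^{p-2}}{(p-1)\,|u'(z)|^{p-2}}\,f(u(z))=0,\qquad u(0)=\alpha,\quad u'(0)=0.$$ That is, if $u(r)$ is a solution of the first problem on an interval $[0,R)$, $R>0$, then the function $w(z)=u\left(z^{1/\bar\beta}\right)$, $0\le z<R^{\bar\beta}$, is a solution of the second problem (with $w$ in place of $u$, and primes denoting derivatives in $z$).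
   Context: A solution of the first problem on $[0,R)$ means a function $u\in C^1[0,R)\cap C^2(0,R)$ with $u\ge 0$, satisfying the initial conditions at $r=0$ and satisfying the differential equation for $0<r<R$, with $u'(r)\neq 0$ there (so that the term with $|u'|^{p-2}$ in the denominator makes sense). Solutions of the second problem are understood analogously, on the corresponding interval in $z$. The first equation is the non-divergence form, with parameter $\lambda=1$, of the radial $p$-Laplace equation $\varphi(u')'+\frac{n-1}{r}\varphi(u')+\lambda f(u)=0$, where $\varphi(v)=v|v|^{p-2}$. *)

theory Defs
  imports Complex_Main
begin

text \<open>
  Functions on an interval are total functions \<open>real \<Rightarrow> real\<close> whose values outside the
  interval are irrelevant; derivatives at the left end point are one-sided.
\<close>

definition C2_on :: "real set \<Rightarrow> (real \<Rightarrow> real) \<Rightarrow> bool" where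
  "C2_on S f \<longleftrightarrow>
     (\<exists>f' f''. (\<forall>x\<in>S. (f has_real_derivative f' x) (at x within S)) \<and>
               (\<forall>x\<in>S. (f' has_real_derivative f'' x) (at x within S)) \<and>
               continuous_on S f'')"

text \<open>
  \<open>E r v v1 v2\<close> is the differential equation at the point \<open>r\<close>, with \<open>v\<close>, \<open>v1\<close>, \<open>v2\<close> the values
  of the unknown function and of its first two derivatives at \<open>r\<close>.  The functions \<open>u'\<close>, \<open>u''\<close> below are
  uniquely determined by \<open>u\<close> on \<open>{0..<R}\<close> and \<open>{0<..<R}\<close>, respectively.
\<close>

definition ivp_solution ::
  "(real \<Rightarrow> real \<Rightarrow> real \<Rightarrow> real \<Rightarrow> bool) \<Rightarrow> real \<Rightarrow> real \<Rightarrow> (real \<Rightarrow> real) \<Rightarrow> bool" where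
  "ivp_solution E \<alpha> R u \<longleftrightarrow>
     (\<exists>u' u''.
        (\<forall>r\<in>{0..<R}. (u has_real_derivative u' r) (at r within {0..<R})) \<and>
        continuous_on {0..<R} u' \<and>
        (\<forall>r\<in>{0<..<R}. (u' has_real_derivative u'' r) (at r)) \<and>
        continuous_on {0<..<R} u'' \<and>
        (\<forall>r\<in>{0..<R}. u r \<ge> 0) \<and>
        u 0 = \<alpha> \<and> u' 0 = 0 \<and>
        (\<forall>r\<in>{0<..<R}. u' r \<noteq> 0 \<and> E r (u r) (u' r) (u'' r)))"

definition radial_p_laplace_eq ::
  "nat \<Rightarrow> real \<Rightarrow> (real \<Rightarrow> real) \<Rightarrow> real \<Rightarrow> real \<Rightarrow> real \<Rightarrow> real \<Rightarrow> bool" where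
  "radial_p_laplace_eq n p f r v v1 v2 \<longleftrightarrow>
     v2 + (real n - 1) / ((p - 1) * r) * v1 + f v / ((p - 1) * \<bar>v1\<bar> powr (p - 2)) = 0"

definition transformed_eq ::
  "real \<Rightarrow> real \<Rightarrow> real \<Rightarrow> (real \<Rightarrow> real) \<Rightarrow> real \<Rightarrow> real \<Rightarrow> real \<Rightarrow> real \<Rightarrow> bool" where
  "transformed_eq a A p f z v v1 v2 \<longleftrightarrow>
     a * v2 + A / z * v1 + z powr (p - 2) / ((p - 1) * \<bar>v1\<bar> powr (p - 2)) * f v = 0"

end

theory Submission
  imports Defs
begin

text \<open>
  With \<open>r = z powr (1 / \<beta>)\<close>, the chain rule shows that the transformed left-hand side is
  \<open>\<beta> powr (p - 2) * z powr (2 / \<beta> - 2)\<close> times the original one: the terms in \<open>\<beta> - 1\<close> cancel,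
  and the powers of \<open>z\<close> in front of \<open>f\<close> agree exactly because \<open>p = 2 * \<beta> * (p - 1)\<close>.  Since
  \<open>1 / \<beta> > 1\<close>, the substitution is \<open>C\<^sup>1\<close> up to \<open>z = 0\<close>.
\<close>

lemma has_real_derivative_powr_nonneg:
  fixes c x :: real
  assumes "c > 1" "x \<ge> 0" "S \<subseteq> {0..}"
  shows "((\<lambda>z. z powr c) has_real_derivative c * x powr (c - 1)) (at x within S)"
proof (cases "x = 0")
  case True
  \<comment> \<open>At 0 the one-sided difference quotient is \<open>y powr (c - 1)\<close>; it
    tends to 0 because \<open>c > 1\<close>.\<close>
  have "((\<lambda>y. y powr (c - 1)) \<longlongrightarrow> 0 powr (c - 1)) (at 0 within {0::real..})"
    by (rule tendsto_powr') (use assms in \<open>auto simp: eventually_at_filter\<close>)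
  moreover have "eventually (\<lambda>y. y powr (c - 1) = (y powr c - 0 powr c) / (y - 0))
      (at 0 within {0::real..})"
    by (auto simp: eventually_at_filter powr_diff)
  ultimately have "((\<lambda>z. z powr c) has_real_derivative 0) (at 0 within {0..})"
    unfolding has_field_derivative_iff by (auto intro: Lim_transform_eventually)
  then show ?thesis
    using True DERIV_subset assms(3) by auto
next
  case False
  with assms have "((\<lambda>z. z powr c) has_real_derivative c * x powr (c - 1)) (at x)"
    by (intro has_real_derivative_powr) auto
  then show ?thesis
    by (rule has_field_derivative_at_within)
qed

text \<open>This is the pointwise algebra of the substitution: \<open>v1\<close>, \<open>v2\<close>
  stand for the r-derivatives at \<open>z powr c\<close>, and the last two arguments are what the
  chain and product rules give for the z-derivatives.\<close>

lemma radial_p_laplace_imp_transformed_eq: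
  fixes n :: nat and p \<beta> z v v1 v2 :: real
  defines "c \<equiv> 1 / \<beta>"
  assumes p: "p > 2" and \<beta>: "\<beta> = p / (2 * (p - 1))" and z: "z > 0"
    and eq: "radial_p_laplace_eq n p f (z powr c) v v1 v2"
  shows "transformed_eq (\<beta> powr p)
    (\<beta> powr (p - 1) * (\<beta> - 1) + (real n - 1) / (p - 1) * \<beta> powr (p - 1)) p f z v
    (v1 * (c * z powr (c - 1)))
    (v2 * (c * z powr (c - 1)) * (c * z powr (c - 1)) + v1 * (c * ((c - 1) * z powr (c - 2))))"
proof -
  have \<beta>0: "\<beta> > 0" and cp: "c * p = 2 * p - 2" and c0: "c > 0"
    using p by (auto simp: \<beta> c_def)
  \<comment> \<open>Every other power of \<open>\<beta>\<close> and \<open>z\<close> in the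
    derivative terms is a monomial in \<open>B\<close>, \<open>Z\<close>, \<open>\<beta>\<close>,
    \<open>z\<close>, so those terms can be compared by rational arithmetic.\<close>
  define B Z where "B = \<beta> powr (p - 2)" and "Z = z powr (c - 2)"
  have Bp: "\<beta> powr p = B * \<beta>\<^sup>2" "\<beta> powr (p - 1) = B * \<beta>" and Z0: "Z > 0"
    and Zc: "z powr (c - 1) = z * Z" "z powr c = z\<^sup>2 * Z"
    using \<beta>0 z unfolding B_def Z_def
    by (auto simp: powr_diff field_simps power2_eq_square)
  \<comment> \<open>The exponents on the left add up to \<open>c * p - p\<close>, which is
    \<open>p - 2\<close> by \<open>cp\<close>.\<close>
  have "(z powr (c - 1)) powr (p - 2) * z powr (2 * c - 2) = z powr (p - 2)"
  proof -
    have "(c - 1) * (p - 2) + (2 * c - 2) = p - 2"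
      using cp by (simp add: algebra_simps)
    then show ?thesis
      by (simp only: powr_powr powr_add[symmetric])
  qed
  moreover have "z powr (2 * c - 2) = (z * Z)\<^sup>2"
    using z by (simp add: power2_eq_square Zc(1)[symmetric] flip: powr_add)
  moreover have "c powr (p - 2) * B = 1"
    using \<beta>0 by (simp add: c_def B_def powr_divide)
  ultimately have K: "z powr (p - 2) = (c * (z * Z)) powr (p - 2) * (B * (z * Z)\<^sup>2)"
    using c0 z Z0 by (simp add: powr_mult Zc(1)) (metis mult.assoc mult.commute mult.right_neutral)
  have abs: "\<bar>v1 * (c * (z * Z))\<bar> powr (p - 2) = \<bar>v1\<bar> powr (p - 2) * (c * (z * Z)) powr (p - 2)"
    using c0 z Z0 by (simp add: abs_mult powr_mult)
  \<comment> \<open>The factor \<open>(c * (z * Z)) powr (p - 2)\<close> in \<open>K\<close> cancels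
    the one in \<open>abs\<close>. If \<open>v1 = 0\<close>, both quotients are 0, since division by
    0 gives 0.\<close>
  have F: "z powr (p - 2) / ((p - 1) * \<bar>v1 * (c * (z * Z))\<bar> powr (p - 2)) * f v
      = B * (z * Z)\<^sup>2 * (f v / ((p - 1) * \<bar>v1\<bar> powr (p - 2)))"
  proof -
    have "(c * (z * Z)) powr (p - 2) > 0"
      using c0 z Z0 by simp
    then show ?thesis
      unfolding abs K by simp
  qed
  define m where "m = (real n - 1) / (p - 1)"
  have m: "(real n - 1) / ((p - 1) * (z\<^sup>2 * Z)) = m / (z\<^sup>2 * Z)"
    by (simp add: m_def)
  \<comment> \<open>As \<open>c * \<beta> = 1\<close>, the second derivative contributes
    \<open>B * (1 - \<beta>) * Z * v1\<close>, which cancels the \<open>\<beta> - 1\<close> part of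
    the first-order term.\<close>
  have "B * \<beta>\<^sup>2 * (v2 * (c * (z * Z)) * (c * (z * Z)) + v1 * (c * ((c - 1) * Z)))
      + (B * \<beta> * (\<beta> - 1) + m * (B * \<beta>)) / z * (v1 * (c * (z * Z)))
      = B * (z * Z)\<^sup>2 * (v2 + m / (z\<^sup>2 * Z) * v1)"
    using \<beta>0 z Z0 by (simp add: c_def field_simps power2_eq_square)
  moreover have "v2 + m / (z\<^sup>2 * Z) * v1 + f v / ((p - 1) * \<bar>v1\<bar> powr (p - 2)) = 0"
    using eq unfolding radial_p_laplace_eq_def Zc m .
  ultimately show ?thesis
    unfolding transformed_eq_def Zc Bp Z_def[symmetric] F m_def[symmetric]
    by (metis distrib_left mult_zero_right)
qed

theorem lemma4p2:
  fixes n :: nat and p \<alpha> \<beta> a A R :: real and f u :: "real \<Rightarrow> real"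
  assumes "n \<ge> 1" and "p > 2" and "\<alpha> > 0" and "C2_on {0..} f"
    and "\<beta> = p / (2 * (p - 1))"
    and "a = \<beta> powr p"
    and "A = \<beta> powr (p - 1) * (\<beta> - 1) + (real n - 1) / (p - 1) * \<beta> powr (p - 1)"
    and "R > 0"
    and "ivp_solution (radial_p_laplace_eq n p f) \<alpha> R u"
  shows "ivp_solution (transformed_eq a A p f) \<alpha> (R powr \<beta>) (\<lambda>z. u (z powr (1 / \<beta>)))"
proof -
  define c where "c = 1 / \<beta>"
  have \<beta>0: "\<beta> > 0" and c1: "c > 1"
    using \<open>p > 2\<close> by (auto simp: assms(5) c_def field_simps)
  have bound: "z powr c < R" if "0 \<le> z" "z < R powr \<beta>" for z
  proof -
    have "z powr c < (R powr \<beta>) powr c"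
      using that c1 by (intro powr_less_mono2) auto
    also have "\<dots> = R"
      using \<open>R > 0\<close> \<beta>0 by (simp add: powr_powr c_def)
    finally show ?thesis .
  qed
  let ?I = "{0..<R powr \<beta>}" and ?J = "{0<..<R powr \<beta>}"
  have map: "(\<lambda>z. z powr c) ` ?I \<subseteq> {0..<R}" "(\<lambda>z. z powr c) ` ?J \<subseteq> {0<..<R}"
    using bound by auto
  from assms(9) obtain u' u'' where
    u: "\<And>r. r \<in> {0..<R} \<Longrightarrow> (u has_real_derivative u' r) (at r within {0..<R})"
    and u'_cont: "continuous_on {0..<R} u'"
    and u': "\<And>r. r \<in> {0<..<R} \<Longrightarrow> (u' has_real_derivative u'' r) (at r)"
    and u''_cont: "continuous_on {0<..<R} u''"
    and nonneg: "\<And>r. r \<in> {0..<R} \<Longrightarrow> u r \<ge> 0"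
    and init: "u 0 = \<alpha>" "u' 0 = 0"
    and eq: "\<And>r. r \<in> {0<..<R} \<Longrightarrow> u' r \<noteq> 0 \<and> radial_p_laplace_eq n p f r (u r) (u' r) (u'' r)"
    unfolding ivp_solution_def by blast
  define w' where "w' z = u' (z powr c) * (c * z powr (c - 1))" for z
  define w'' where "w'' z = u'' (z powr c) * (c * z powr (c - 1)) * (c * z powr (c - 1))
      + u' (z powr c) * (c * ((c - 1) * z powr (c - 2)))" for z
  have "((\<lambda>z. u (z powr c)) has_real_derivative w' z) (at z within ?I)" if "z \<in> ?I" for z
  proof -
    \<comment> \<open>Restricting to the image of \<open>?I\<close> gives the form of the chain rule
      that keeps the derivative one-sided at 0.\<close>
    have "(u has_real_derivative u' (z powr c)) (at (z powr c) within (\<lambda>z. z powr c) ` ?I)"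
      using u[of "z powr c"] map(1) that by (blast intro: DERIV_subset)
    moreover have "((\<lambda>z. z powr c) has_real_derivative c * z powr (c - 1)) (at z within ?I)"
      using that c1 by (intro has_real_derivative_powr_nonneg) auto
    ultimately show ?thesis
      using DERIV_image_chain[of u] by (simp add: w'_def o_def)
  qed
  \<comment> \<open>Continuity of \<open>z powr (c - 1)\<close> at 0 comes from the positive
    exponent.\<close>
  moreover have "continuous_on ?I w'"
    unfolding w'_def using map(1) c1
    by (intro continuous_intros continuous_on_compose2[OF u'_cont] continuous_on_powr') auto
  moreover have "(w' has_real_derivative w'' z) (at z)" if "z \<in> ?J" for z
  proof -
    have d: "((\<lambda>z. z powr e) has_real_derivative e * z powr (e - 1)) (at z)" for e
      using that by (intro has_real_derivative_powr) auto
    have "((\<lambda>z. u' (z powr c)) has_real_derivative u'' (z powr c) * (c * z powr (c - 1))) (at z)"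
      using u'[of "z powr c"] map(2) that by (intro DERIV_chain2[OF _ d]) blast
    from DERIV_mult[OF this DERIV_cmult[OF d[of "c - 1"], of c]] show ?thesis
      unfolding w'_def w''_def by (simp add: algebra_simps)
  qed
  \<comment> \<open>Here \<open>c - 2 = - 2 / p < 0\<close>, so \<open>z powr (c - 2)\<close> is
    unbounded near 0; on \<open>?J\<close> the base is positive.\<close>
  moreover have "continuous_on ?J w''"
  proof -
    have "continuous_on ?J (\<lambda>z. u' (z powr c))"
      using map(2) c1
      by (intro continuous_on_compose2[OF continuous_on_subset[OF u'_cont, of "{0<..<R}"]]
            continuous_intros) auto
    moreover have "continuous_on ?J (\<lambda>z. u'' (z powr c))"
      using map(2) by (intro continuous_on_compose2[OF u''_cont] continuous_intros) auto
    ultimately show ?thesis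
      unfolding w''_def by (intro continuous_intros) auto
  qed
  moreover have "w' z \<noteq> 0 \<and> transformed_eq a A p f z (u (z powr c)) (w' z) (w'' z)"
    if "z \<in> ?J" for z
  proof -
    have r: "z powr c \<in> {0<..<R}"
      using map(2) that by blast
    have "transformed_eq a A p f z (u (z powr c)) (w' z) (w'' z)"
      unfolding w'_def w''_def assms(6,7) c_def
      using that eq[OF r] assms(2,5)
      by (intro radial_p_laplace_imp_transformed_eq) (auto simp: c_def)
    moreover have "w' z \<noteq> 0"
      using eq[OF r] that c1 by (simp add: w'_def)
    ultimately show ?thesis by blast
  qed
  moreover have "u (z powr c) \<ge> 0" if "z \<in> ?I" for z
    using nonneg map(1) that by blast
  \<comment> \<open>Both use \<open>0 powr c = 0\<close>, so the end point \<open>z = 0\<close>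
    corresponds to \<open>r = 0\<close>.\<close>
  moreover have "u (0 powr c) = \<alpha>" "w' 0 = 0"
    using init by (auto simp: w'_def)
  ultimately show ?thesis
    unfolding ivp_solution_def c_def[symmetric] by blast
qed

end
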